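(* The semantics $\mathit{cf2}$, $\mathit{stg2}$ and $\mathit{tfstg2}$ do not satisfy finitary directionality: for each $\sigma\in\{\mathit{cf2},\mathit{stg2},\mathit{tfstg2}\}$ there is a finitary argumentation framework $\mathcal{F}$ and a set $U\subseteq A_{\mathcal{F}}$ not attacked from outside $U$ such that $\sigma(\mathcal{F}|_U)\neq\{S\cap U: S\in\sigma(\mathcal{F})\}$.
   Context: An argumentation framework (AF) is $\mathcal{F}=(A_{\mathcal{F}},R_{\mathcal{F}})$ with $R_{\mathcal{F}}\subseteq A_{\mathcal{F}}\times A_{\mathcal{F}}$; $a\rightarrow b$ means $(a,b)\in R_{\mathcal{F}}$. $\mathcal{F}$ is finitary if each argument has finitely many attackers. $U$ is not attacked from outside $U$ if there are no $a\notin U$, $b\in U$ with $a\rightarrow b$. A semantics $\sigma$ satisfies finitary directionality if for every finitary $\mathcal{F}$ and every such $U$, $\sigma(\mathcal{F}|_U)=\{S\cap U:S\in\sigma(\mathcal{F})\}$. $\mathcal{F}|_S=(A_{\mathcal{F}}\cap S,R_{\mathcal{F}}\cap(S\times S))$. Conflict-free: no $a,b\in S$ with $a\rightarrow b$; $S^\oplus=S\cup\{x:\exists y\in S,\ y\rightarrow x\}$; naive = $\subseteq$-maximal conflict-free; stage = conflict-free $S$ with no conflict-free $T$ having $S^\oplus\subsetneq T^\oplus$. $\mathrm{SCC}(a)$: set of $b$ with directed attack paths (possibly length 0) from $a$ to $b$ and back; $\mathrm{SCC}(\mathcal{F})$ the set of components. $D_S(X)=\{b\in X:\exists a\in S\setminus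 X,\ a\rightarrow b\}$. $\mathit{cf2}$: $S\in\mathit{cf2}(\mathcal{F})$ iff either $|\mathrm{SCC}(\mathcal{F})|=1$ and $S$ is naive in $\mathcal{F}$, or $|\mathrm{SCC}(\mathcal{F})|\ne1$ and for each $X\in\mathrm{SCC}(\mathcal{F})$, $S\cap X\in\mathit{cf2}(\mathcal{F}|_{X\setminus D_S(X)})$, recursively. For infinite AFs this recursion may not terminate; $S$ counts as a member of $\mathit{cf2}(\mathcal{F})$ only if the tree of recursive calls has no infinite branch (the recursion is well-defined) and the condition holds at all its leaves. $\mathit{stg2}$ is the same with stage in place of naive. $\mathit{tfstg2}$: $C^0_S(a)=\mathrm{SCC}(a)$; $C^{\alpha+1}_S(a)$ = component of $a$ in $\mathcal{F}|_{C^\alpha_S(a)\setminus D_S(C^\alpha_S(a))}$ (empty if $a$ is not there); for limit $\lambda$, $C^\lambda_S(a)$ = component of $a$ in $\mathcal{F}|_{\bigcap_{\alpha<\lambda}C^\alpha_S(a)}$; $\alpha_S(a)$ = least $\alpha$ with $a\notin C^\alpha_S(a)$ or $C^{\alpha+1}_S(a)=C^\alpha_S(a)$; $S\in\mathit{tfstg2}(\mathcal{F})$ iff $S$ is conflict-free and for each $a$, either $a\notin C^{\alpha_S(a)}_S(a)$ or $S\cap C^{\alpha_S(a)}_S(a)$ is a stage extension of $\mathcal{F}|_{C^{\alpha_S(a)}_S(a)}$. *)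

theory Defs
  imports Main
begin

type_synonym 'a af = "'a set \<times> ('a \<times> 'a) set"

definition args :: "'a af \<Rightarrow> 'a set" where "args F = fst F"
definition att :: "'a af \<Rightarrow> ('a \<times> 'a) set" where "att F = snd F"

definition af_wf :: "'a af \<Rightarrow> bool" where
  "af_wf F \<longleftrightarrow> att F \<subseteq> args F \<times> args F"

definition finitary :: "'a af \<Rightarrow> bool" where
  "finitary F \<longleftrightarrow> (\<forall>b \<in> args F. finite {a. (a, b) \<in> att F})"

definition restrict :: "'a af \<Rightarrow> 'a set \<Rightarrow> 'a af" where
  "restrict F S = (args F \<inter> S, att F \<inter> (S \<times> S))"

definition unattacked :: "'a af \<Rightarrow> 'a set \<Rightarrow> bool" where
  "unattacked F U \<longleftrightarrow> \<not> (\<exists>a b. a \<notin> U \<and> b \<in> U \<and> (a, b) \<in> att F)"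

definition conflict_free :: "'a af \<Rightarrow> 'a set \<Rightarrow> bool" where
  "conflict_free F S \<longleftrightarrow> S \<subseteq> args F \<and> \<not> (\<exists>a \<in> S. \<exists>b \<in> S. (a, b) \<in> att F)"

definition plus_range :: "'a af \<Rightarrow> 'a set \<Rightarrow> 'a set" where
  "plus_range F S = S \<union> {x. \<exists>y \<in> S. (y, x) \<in> att F}"

definition naive :: "'a af \<Rightarrow> 'a set \<Rightarrow> bool" where
  "naive F S \<longleftrightarrow> conflict_free F S \<and> (\<forall>T. conflict_free F T \<and> S \<subseteq> T \<longrightarrow> T = S)"

definition stage :: "'a af \<Rightarrow> 'a set \<Rightarrow> bool" where
  "stage F S \<longleftrightarrow> conflict_free F S \<and> \<not> (\<exists>T. conflict_free F T \<and> plus_range F S \<subset> plus_range F T)"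

definition scc :: "'a af \<Rightarrow> 'a \<Rightarrow> 'a set" where
  "scc F a = {b. (a, b) \<in> (att F)\<^sup>* \<and> (b, a) \<in> (att F)\<^sup>*}"

definition sccs :: "'a af \<Rightarrow> 'a set set" where
  "sccs F = scc F ` args F"

definition Dset :: "'a af \<Rightarrow> 'a set \<Rightarrow> 'a set \<Rightarrow> 'a set" where
  "Dset F S X = {b \<in> X. \<exists>a \<in> S - X. (a, b) \<in> att F}"

text \<open>The recursive definition is rendered as an inductive predicate: membership holds
  exactly when the (deterministic) tree of recursive calls is well-founded and the
  base condition holds at every leaf.\<close>

inductive cf2 :: "'a af \<Rightarrow> 'a set \<Rightarrow> bool" where
  cf2_base: "(\<exists>X. sccs F = {X}) \<Longrightarrow> naive F S \<Longrightarrow> cf2 F S"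
| cf2_rec: "\<not> (\<exists>X. sccs F = {X}) \<Longrightarrow> S \<subseteq> args F \<Longrightarrow>
    (\<forall>X \<in> sccs F. cf2 (restrict F (X - Dset F S X)) (S \<inter> X)) \<Longrightarrow> cf2 F S"

inductive stg2 :: "'a af \<Rightarrow> 'a set \<Rightarrow> bool" where
  stg2_base: "(\<exists>X. sccs F = {X}) \<Longrightarrow> stage F S \<Longrightarrow> stg2 F S"
| stg2_rec: "\<not> (\<exists>X. sccs F = {X}) \<Longrightarrow> S \<subseteq> args F \<Longrightarrow>
    (\<forall>X \<in> sccs F. stg2 (restrict F (X - Dset F S X)) (S \<inter> X)) \<Longrightarrow> stg2 F S"

definition comp :: "'a af \<Rightarrow> 'a \<Rightarrow> 'a set" where
  "comp G a = (if a \<in> args G then scc G a else {})"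

definition tf_step :: "'a af \<Rightarrow> 'a set \<Rightarrow> 'a \<Rightarrow> 'a set \<Rightarrow> 'a set" where
  "tf_step F S a C = comp (restrict F (C - Dset F S C)) a"

text \<open>The set of all transfinite iterates C^alpha_S(a), alpha an ordinal: the least
  family containing C^0 = SCC(a), closed under the successor step and under the
  limit step (component of a in the intersection of a nonempty family of iterates;
  iterates form a decreasing sequence, so such families are exactly the initial
  segments / cofinal subsets of limit stages).\<close>
inductive_set tf_stages :: "'a af \<Rightarrow> 'a set \<Rightarrow> 'a \<Rightarrow> 'a set set"
  for F :: "'a af" and S :: "'a set" and a :: 'a where
  tf_zero: "comp F a \<in> tf_stages F S a"
| tf_succ: "C \<in> tf_stages F S a \<Longrightarrow> tf_step F S a C \<in> tf_stages F S a"
| tf_lim: "(\<forall>C \<in> K. C \<in> tf_stages F S a) \<Longrightarrow> K \<noteq> {} \<Longrightarrow> comp (restrict F (\<Inter>K)) a \<in> tf_stages F S a"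

definition tf_terminal :: "'a af \<Rightarrow> 'a set \<Rightarrow> 'a \<Rightarrow> 'a set \<Rightarrow> bool" where
  "tf_terminal F S a C \<longleftrightarrow> a \<notin> C \<or> tf_step F S a C = C"

text \<open>C^{alpha_S(a)}_S(a): the iterate at the least ordinal that is terminal; as the
  iterates decrease, this is the subset-largest terminal iterate.\<close>
definition tf_final :: "'a af \<Rightarrow> 'a set \<Rightarrow> 'a \<Rightarrow> 'a set \<Rightarrow> bool" where
  "tf_final F S a C \<longleftrightarrow> C \<in> tf_stages F S a \<and> tf_terminal F S a C \<and>
     (\<forall>C' \<in> tf_stages F S a. tf_terminal F S a C' \<longrightarrow> C' \<subseteq> C)"

definition tfstg2 :: "'a af \<Rightarrow> 'a set \<Rightarrow> bool" where
  "tfstg2 F S \<longleftrightarrow> conflict_free F S \<and>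
     (\<forall>a \<in> args F. \<forall>C. tf_final F S a C \<longrightarrow>
        a \<notin> C \<or> stage (restrict F C) (S \<inter> C))"

end

theory Submission
  imports Defs "HOL-Library.Nat_Bijection"
begin

text \<open>
  The empty set is never attacked, and it is the only extension of the empty framework.
  So it suffices to find finitary frameworks without any extension.

  For cf2 and stg2, let every i attack i + 1 and let 2n + 3 attack 2n + 1. The components are
  \<open>{0}\<close> and \<open>{1..}\<close>; the unattacked argument 0 is selected and deletes 1, and what remains
  of the second component is a shifted copy of the whole framework. The recursion never ends.

  For tfstg2 we realise Yablo's paradox. Layer n consists of o, w, a(i), b(i) with attacks
  o \<rightarrow> w \<rightarrow> w, w \<rightarrow> a(i) \<rightarrow> b(i), b(i + 1) \<rightarrow> a(i), b(0) \<rightarrow> o, and a(i) is also attacked by the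
  argument o of layer n + 1 + i. If the selected arguments of the higher layers delete nothing,
  layer n is a final component with the stable extension consisting of o and all a(i), so every
  stage extension covers w and contains o. If some a(i) is deleted, then b(i) is left without
  attackers, is selected and deletes a(i - 1), and so on down to b(0), which attacks o. Hence o is
  selected in layer n iff it is selected in no higher layer, which is impossible.
\<close>

section \<open>Non-terminating recursion\<close>

text \<open>Starting the copy at \<open>2 * n\<close> makes the remainder of \<open>ladder n\<close>
  equal, not merely isomorphic, to \<open>ladder (Suc n)\<close>.\<close>

definition ladder :: "nat \<Rightarrow> nat af" where
  "ladder n = ({2 * n..}, {(i, j). 2 * n \<le> i \<and> 2 * n \<le> j \<and> (j = Suc i \<or> odd i \<and> i = j + 2)})"

lemma af_wf_ladder: "af_wf (ladder n)"
  by (auto simp: af_wf_def ladder_def args_def att_def)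

lemma finitary_ladder: "finitary (ladder n)"
  unfolding finitary_def
proof
  fix b
  have "{a. (a, b) \<in> att (ladder n)} \<subseteq> {..b + 2}"
    by (auto simp: ladder_def att_def)
  then show "finite {a. (a, b) \<in> att (ladder n)}"
    using finite_subset by blast
qed

section \<open>Strongly connected components of the ladder\<close>

lemma ladder_up:
  assumes "2 * n \<le> i" "i \<le> j"
  shows "(i, j) \<in> (att (ladder n))\<^sup>*"
  using assms(2)
proof (induction j rule: dec_induct)
  case (step j)
  have "(j, Suc j) \<in> att (ladder n)"
    using step assms by (auto simp: ladder_def att_def)
  with step show ?case by (meson rtrancl.rtrancl_into_rtrancl)
qed simp

lemma ladder_down: "(2 * n + 1 + 2 * k, 2 * n + 1) \<in> (att (ladder n))\<^sup>*"
proof (induction k)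
  case (Suc k)
  have "(2 * n + 1 + 2 * Suc k, 2 * n + 1 + 2 * k) \<in> att (ladder n)"
    by (auto simp: ladder_def att_def)
  with Suc show ?case by (meson converse_rtrancl_into_rtrancl)
qed simp

text \<open>Climb from \<open>i\<close> to an odd number, descend by twos to
  \<open>2 * n + 1\<close>, then climb to \<open>j\<close>.\<close>

lemma ladder_connected:
  assumes "2 * n < i" "2 * n < j"
  shows "(i, j) \<in> (att (ladder n))\<^sup>*"
proof -
  obtain k where k: "i \<le> 2 * n + 1 + 2 * k"
    by (metis add_leE le_add2 mult_2)
  have "(i, 2 * n + 1 + 2 * k) \<in> (att (ladder n))\<^sup>*"
    using ladder_up k assms by simp
  also have "(2 * n + 1 + 2 * k, 2 * n + 1) \<in> (att (ladder n))\<^sup>*"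
    by (rule ladder_down)
  also have "(2 * n + 1, j) \<in> (att (ladder n))\<^sup>*"
    using assms by (intro ladder_up) auto
  finally show ?thesis .
qed

text \<open>Any predecessor of \<open>2 * n\<close> lies outside the ladder, and jumps by two start
  at odd numbers, so \<open>2 * n\<close> is unattacked.\<close>

lemma ladder_source:
  assumes "(i, 2 * n) \<in> (att (ladder n))\<^sup>*"
  shows "i = 2 * n"
  using assms
proof (cases rule: rtranclE)
  case (step y)
  then show ?thesis by (auto simp: ladder_def att_def)
qed

lemma ladder_reach_ge:
  assumes "(i, j) \<in> (att (ladder n))\<^sup>*" "2 * n \<le> i"
  shows "2 * n \<le> j"
  using assms by (induction rule: rtrancl_induct) (auto simp: ladder_def att_def)

lemma scc_ladder_source: "scc (ladder n) (2 * n) = {2 * n}"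
  using ladder_source by (auto simp: scc_def)

lemma scc_ladder_rest:
  assumes "2 * n < i"
  shows "scc (ladder n) i = {2 * n<..}"
proof
  show "scc (ladder n) i \<subseteq> {2 * n<..}"
    using assms ladder_reach_ge ladder_source by (force simp: scc_def order_less_le)
  show "{2 * n<..} \<subseteq> scc (ladder n) i"
    using assms ladder_connected by (auto simp: scc_def)
qed

lemma sccs_ladder: "sccs (ladder n) = {{2 * n}, {2 * n<..}}"
proof -
  have "args (ladder n) = insert (2 * n) {2 * n<..}"
    by (auto simp: args_def ladder_def)
  moreover have "scc (ladder n) ` {2 * n<..} = {{2 * n<..}}"
  proof -
    have "Suc (2 * n) \<in> {2 * n<..}" by simp
    then show ?thesis using scc_ladder_rest by (auto simp: image_iff)
  qed
  ultimately show ?thesis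
    by (simp add: sccs_def scc_ladder_source)
qed

lemma sccs_ladder_not_singleton: "\<nexists>X. sccs (ladder n) = {X}"
proof -
  have "{2 * n} \<noteq> {2 * n<..}" by blast
  then show ?thesis by (auto simp: sccs_ladder doubleton_eq_iff)
qed

section \<open>Remainders of the ladder after deletion\<close>

lemma restrict_ladder_source:
  "restrict (ladder n) ({2 * n} - Dset (ladder n) S {2 * n}) = ({2 * n}, {})"
  by (auto simp: restrict_def Dset_def ladder_def args_def att_def)

lemma restrict_ladder:
  assumes "n \<le> m"
  shows "restrict (ladder n) {2 * m..} = ladder m"
proof -
  have le: "2 * n \<le> i" if "2 * m \<le> i" for i
    using assms that by linarith
  then have "args (restrict (ladder n) {2 * m..}) = args (ladder m)"
    by (auto simp: restrict_def ladder_def args_def)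
  moreover have "att (restrict (ladder n) {2 * m..}) = att (ladder m)"
    using le unfolding restrict_def ladder_def att_def by (simp, blast)
  ultimately show ?thesis
    by (simp add: args_def att_def prod_eq_iff)
qed

text \<open>The one ladder argument outside the component is \<open>2 * n\<close>, and it attacks
  only \<open>2 * n + 1\<close>.\<close>

lemma restrict_ladder_rest:
  assumes "2 * n \<in> S"
  shows "restrict (ladder n) ({2 * n<..} - Dset (ladder n) S {2 * n<..}) = ladder (Suc n)"
proof -
  have "Dset (ladder n) S {2 * n<..} = {2 * n + 1}"
    using assms by (auto simp: Dset_def ladder_def att_def)
  moreover have "{2 * n<..} - {2 * n + 1} = {2 * Suc n..}" by auto
  ultimately show ?thesis by (simp only: restrict_ladder[OF le_SucI[OF order_refl]])
qed

section \<open>Isolated arguments and the infinite descent\<close>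

lemma sccs_isolated: "sccs ({x}, {}) = {{x}}"
  by (auto simp: sccs_def scc_def args_def att_def)

lemma naive_isolated: "naive ({x}, {}) T \<Longrightarrow> x \<in> T"
  by (auto simp: naive_def conflict_free_def args_def att_def)

lemma stage_isolated:
  assumes "stage ({x}, {}) T"
  shows "x \<in> T"
proof (rule ccontr)
  assume "x \<notin> T"
  then have "T = {}" using assms by (auto simp: stage_def conflict_free_def args_def)
  moreover have "conflict_free ({x}, {}) {x}"
    by (auto simp: conflict_free_def args_def att_def)
  ultimately show False
    using assms by (auto simp: stage_def plus_range_def att_def)
qed

lemma cf2_isolated: "cf2 ({x}, {}) T \<Longrightarrow> x \<in> T"
  by (erule cf2.cases) (auto simp: sccs_isolated naive_isolated)

lemma stg2_isolated: "stg2 ({x}, {}) T \<Longrightarrow> x \<in> T"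
  by (erule stg2.cases) (auto simp: sccs_isolated stage_isolated)

text \<open>Induction on the derivation with \<open>n\<close> arbitrary: a derivation for one ladder
  would contain a smaller one for the next.\<close>

lemma cf2_not_ladder: "cf2 F S \<Longrightarrow> F \<noteq> ladder n"
proof (induction arbitrary: n rule: cf2.induct)
  case (cf2_base F S)
  then show ?case using sccs_ladder_not_singleton by metis
next
  case (cf2_rec F S)
  show ?case
  proof
    assume F: "F = ladder n"
    have rec: "cf2 (restrict (ladder n) (X - Dset (ladder n) S X)) (S \<inter> X)"
      and IH: "restrict (ladder n) (X - Dset (ladder n) S X) \<noteq> ladder m"
      if "X \<in> {{2 * n}, {2 * n<..}}" for X m
      using cf2_rec(3) that unfolding F sccs_ladder by blast+
    have "cf2 ({2 * n}, {}) (S \<inter> {2 * n})"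
      using rec[of "{2 * n}"] unfolding restrict_ladder_source by blast
    then have "2 * n \<in> S" by (auto dest: cf2_isolated)
    then show False
      using IH[of "{2 * n<..}" "Suc n"] by (simp add: restrict_ladder_rest)
  qed
qed

lemma stg2_not_ladder: "stg2 F S \<Longrightarrow> F \<noteq> ladder n"
proof (induction arbitrary: n rule: stg2.induct)
  case (stg2_base F S)
  then show ?case using sccs_ladder_not_singleton by metis
next
  case (stg2_rec F S)
  show ?case
  proof
    assume F: "F = ladder n"
    have rec: "stg2 (restrict (ladder n) (X - Dset (ladder n) S X)) (S \<inter> X)"
      and IH: "restrict (ladder n) (X - Dset (ladder n) S X) \<noteq> ladder m"
      if "X \<in> {{2 * n}, {2 * n<..}}" for X m
      using stg2_rec(3) that unfolding F sccs_ladder by blast+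
    have "stg2 ({2 * n}, {}) (S \<inter> {2 * n})"
      using rec[of "{2 * n}"] unfolding restrict_ladder_source by blast
    then have "2 * n \<in> S" by (auto dest: stg2_isolated)
    then show False
      using IH[of "{2 * n<..}" "Suc n"] by (simp add: restrict_ladder_rest)
  qed
qed

section \<open>Transfinite iterates\<close>

lemma comp_restrict_mono:
  assumes "C \<subseteq> C'"
  shows "comp (restrict F C) a \<subseteq> comp (restrict F C') a"
proof -
  have "(att (restrict F C))\<^sup>* \<subseteq> (att (restrict F C'))\<^sup>*"
    using assms by (intro rtrancl_mono) (auto simp: restrict_def att_def)
  then show ?thesis
    using assms by (auto simp: comp_def scc_def restrict_def args_def)
qed

lemma comp_restrict_subset_comp: "comp (restrict F C) a \<subseteq> comp F a"
proof -
  have "(att (restrict F C))\<^sup>* \<subseteq> (att F)\<^sup>*"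
    by (intro rtrancl_mono) (auto simp: restrict_def att_def)
  then show ?thesis
    by (auto simp: comp_def scc_def restrict_def args_def)
qed

lemma comp_restrict_subset: "comp (restrict F C) a \<subseteq> C"
proof
  fix b
  assume b: "b \<in> comp (restrict F C) a"
  then have "a \<in> C"
    by (auto simp: comp_def restrict_def args_def split: if_splits)
  moreover have "(a, b) \<in> (att (restrict F C))\<^sup>*"
    using b by (auto simp: comp_def scc_def split: if_splits)
  ultimately show "b \<in> C"
    by (auto elim: rtranclE simp: restrict_def att_def)
qed

lemma tf_step_mono:
  assumes "C \<subseteq> C'"
  shows "tf_step F S a C \<subseteq> tf_step F S a C'"
proof -
  have "C - Dset F S C \<subseteq> C' - Dset F S C'"
    using assms by (auto simp: Dset_def)
  then show ?thesis
    unfolding tf_step_def by (rule comp_restrict_mono)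
qed

lemma tf_step_subset: "tf_step F S a C \<subseteq> C - Dset F S C"
  unfolding tf_step_def by (rule comp_restrict_subset)

lemma tf_stages_subset_comp: "C \<in> tf_stages F S a \<Longrightarrow> C \<subseteq> comp F a"
  by (induction rule: tf_stages.induct) (auto simp: tf_step_def dest!: subsetD[OF comp_restrict_subset_comp])

text \<open>An argument that \<open>S\<close> does not attack is never deleted, and a component
  contains its base point.\<close>

lemma tf_stages_mem:
  assumes "a \<in> args F" "\<And>x. x \<in> S \<Longrightarrow> (x, a) \<notin> att F" "C \<in> tf_stages F S a"
  shows "a \<in> C"
  using assms(3)
proof (induction rule: tf_stages.induct)
  case tf_zero
  then show ?case using assms(1) by (simp add: comp_def scc_def)
next
  case (tf_succ C)
  then show ?case
    using assms by (auto simp: tf_step_def comp_def scc_def restrict_def args_def Dset_def)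
next
  case (tf_lim K)
  then show ?case
    using assms by (auto simp: comp_def scc_def restrict_def args_def)
qed

lemma tf_fixpointD:
  assumes "tf_step F S a C = C"
  shows "Dset F S C = {}" and "comp (restrict F C) a = C"
proof -
  show D: "Dset F S C = {}"
    using tf_step_subset[of F S a C] assms by (auto simp: Dset_def)
  show "comp (restrict F C) a = C"
    using assms by (simp add: tf_step_def D)
qed

text \<open>Monotonicity replaces a comparison of ordinals: if \<open>C'\<close> lies below
  \<open>C\<close>, then \<open>C'\<close>, being its own step, lies below the step of
  \<open>C\<close>; limits are similar.\<close>

lemma tf_fixpoint_least:
  assumes "C' \<in> tf_stages F S a" "tf_step F S a C' = C'" "C \<in> tf_stages F S a"
  shows "C' \<subseteq> C"
  using assms(3)
proof (induction rule: tf_stages.induct)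
  case tf_zero
  then show ?case using assms(1) by (rule tf_stages_subset_comp)
next
  case (tf_succ C)
  then show ?case using tf_step_mono assms(2) by metis
next
  case (tf_lim K)
  then have "C' \<subseteq> \<Inter>K" by blast
  then have "comp (restrict F C') a \<subseteq> comp (restrict F (\<Inter>K)) a"
    by (rule comp_restrict_mono)
  then show ?case using tf_fixpointD(2)[OF assms(2)] by simp
qed

text \<open>\<open>tfstg2\<close> constrains \<open>a\<close> only through final iterates, so one
  must be produced. The limit over all iterates is again an iterate, hence the least one.\<close>

lemma tf_final_exists:
  assumes "a \<in> args F" "\<And>x. x \<in> S \<Longrightarrow> (x, a) \<notin> att F"
  obtains C where "tf_final F S a C" "a \<in> C"
proof -
  let ?K = "tf_stages F S a"
  define M where "M = comp (restrict F (\<Inter>?K)) a"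
  have M: "M \<in> ?K"
    unfolding M_def using tf_zero[of F a S] by (intro tf_lim) blast+
  have least: "M \<subseteq> C" if "C \<in> ?K" for C
    using comp_restrict_subset[of F "\<Inter>?K" a] that unfolding M_def by blast
  \<comment> \<open>The step can only shrink \<open>M\<close>, yet it yields an iterate and so
    contains the least one.\<close>
  have step: "tf_step F S a M = M"
    using least[OF tf_succ[OF M]] tf_step_subset[of F S a M] by blast
  \<comment> \<open>A terminal iterate still contains \<open>a\<close>, so it is a fixed point and
    lies below every iterate, in particular \<open>M\<close>.\<close>
  have "C \<subseteq> M" if "C \<in> ?K" "tf_terminal F S a C" for C
  proof -
    have "tf_step F S a C = C"
      using that tf_stages_mem[OF assms] by (auto simp: tf_terminal_def)
    then show ?thesis using tf_fixpoint_least that M by metis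
  qed
  then have "tf_final F S a M"
    using M step by (auto simp: tf_final_def tf_terminal_def)
  moreover have "a \<in> M" using tf_stages_mem[OF assms M] .
  ultimately show ?thesis by (rule that)
qed

text \<open>Take the last edge of a path inside \<open>C\<close> from \<open>y\<close> through
  \<open>a\<close> to \<open>x\<close>.\<close>

lemma comp_internal_attacker:
  assumes "comp (restrict F C) a = C" "x \<in> C" "y \<in> C" "x \<noteq> y"
  obtains z where "z \<in> C" "(z, x) \<in> att F"
proof -
  have "(y, a) \<in> (att (restrict F C))\<^sup>*" "(a, x) \<in> (att (restrict F C))\<^sup>*"
    using assms(1-3) by (auto simp: comp_def scc_def split: if_splits)
  then have "(y, x) \<in> (att (restrict F C))\<^sup>*" by (rule rtrancl_trans)
  then obtain z where "(z, x) \<in> att (restrict F C)"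
    using assms(4) by (auto elim: rtranclE)
  then show ?thesis using that by (auto simp: restrict_def att_def)
qed

section \<open>A finitary Yablo framework\<close>

text \<open>The second coordinates 0, 1, even from 2 and odd from 3 partition the naturals, so the
  four kinds of nodes exhaust \<open>nat\<close>.\<close>

definition out :: "nat \<Rightarrow> nat" where "out n = prod_encode (n, 0)"
definition wit :: "nat \<Rightarrow> nat" where "wit n = prod_encode (n, 1)"
definition alt :: "nat \<Rightarrow> nat \<Rightarrow> nat" where "alt n i = prod_encode (n, 2 * i + 2)"
definition blk :: "nat \<Rightarrow> nat \<Rightarrow> nat" where "blk n i = prod_encode (n, 2 * i + 3)"

definition layer :: "nat \<Rightarrow> nat" where "layer x = fst (prod_decode x)"

lemma layer_simps [simp]:
  "layer (out n) = n" "layer (wit n) = n" "layer (alt n i) = n" "layer (blk n i) = n"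
  by (simp_all add: layer_def out_def wit_def alt_def blk_def)

lemma node_eq_simps [simp]:
  "out n = out m \<longleftrightarrow> n = m"
  "wit n = wit m \<longleftrightarrow> n = m"
  "alt n i = alt m j \<longleftrightarrow> n = m \<and> i = j"
  "blk n i = blk m j \<longleftrightarrow> n = m \<and> i = j"
  "out n \<noteq> wit m" "wit m \<noteq> out n"
  "out n \<noteq> alt m j" "alt m j \<noteq> out n"
  "out n \<noteq> blk m j" "blk m j \<noteq> out n"
  "wit n \<noteq> alt m j" "alt m j \<noteq> wit n"
  "wit n \<noteq> blk m j" "blk m j \<noteq> wit n"
  "alt n i \<noteq> blk m j" "blk m j \<noteq> alt n i"
  by (auto simp: out_def wit_def alt_def blk_def) presburger+

lemma node_cases:
  obtains n where "x = out n" | n where "x = wit n"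
  | n i where "x = alt n i" | n i where "x = blk n i"
proof -
  obtain n k where x: "x = prod_encode (n, k)"
    by (metis prod_decode_inverse surj_pair)
  have "k = 0 \<or> k = 1 \<or> (\<exists>i. k = 2 * i + 2) \<or> (\<exists>i. k = 2 * i + 3)"
    by presburger
  then show ?thesis
    using that unfolding x out_def wit_def alt_def blk_def by blast
qed

text \<open>Giving each higher layer its own target \<open>alt n i\<close> keeps every argument at
  three attackers or fewer; direct attacks from all higher layers on \<open>out n\<close> would be
  infinitely many.\<close>

inductive_set yablo_att :: "(nat \<times> nat) set" where
  out_wit: "(out n, wit n) \<in> yablo_att"
| wit_wit: "(wit n, wit n) \<in> yablo_att"
| wit_alt: "(wit n, alt n i) \<in> yablo_att"
| alt_blk: "(alt n i, blk n i) \<in> yablo_att"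
| blk_alt: "(blk n (Suc i), alt n i) \<in> yablo_att"
| blk_out: "(blk n 0, out n) \<in> yablo_att"
| out_alt: "(out (Suc (n + i)), alt n i) \<in> yablo_att"

definition yablo :: "nat af" where "yablo = (UNIV, yablo_att)"

lemma args_yablo [simp]: "args yablo = UNIV"
  and att_yablo [simp]: "att yablo = yablo_att"
  by (simp_all add: yablo_def args_def att_def)

lemma yablo_attackers:
  "(x, out n) \<in> yablo_att \<longleftrightarrow> x = blk n 0"
  "(x, wit n) \<in> yablo_att \<longleftrightarrow> x = out n \<or> x = wit n"
  "(x, alt n i) \<in> yablo_att \<longleftrightarrow> x = wit n \<or> x = blk n (Suc i) \<or> x = out (Suc (n + i))"
  "(x, blk n i) \<in> yablo_att \<longleftrightarrow> x = alt n i"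
  by (auto elim: yablo_att.cases intro: yablo_att.intros)

lemma af_wf_yablo: "af_wf yablo"
  by (simp add: af_wf_def)

lemma finitary_yablo: "finitary yablo"
  unfolding finitary_def
proof
  fix b
  show "finite {a. (a, b) \<in> att yablo}"
    by (cases b rule: node_cases) (simp_all add: yablo_attackers)
qed

section \<open>Components of the Yablo framework\<close>

lemma yablo_layer_mono:
  assumes "(x, y) \<in> yablo_att\<^sup>*"
  shows "layer y \<le> layer x"
  using assms
proof (induction rule: rtrancl_induct)
  case (step y z)
  from step(2) have "layer z \<le> layer y" by cases auto
  with step show ?case by simp
qed simp

text \<open>Attacks never lead to a higher layer, so the layer is constant on a component.\<close>

lemma comp_yablo_subset: "comp yablo x \<subseteq> {y. layer y = layer x}"
proof
  fix y
  assume "y \<in> comp yablo x"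
  then have "(x, y) \<in> yablo_att\<^sup>*" "(y, x) \<in> yablo_att\<^sup>*"
    by (simp_all add: comp_def scc_def)
  then show "y \<in> {y. layer y = layer x}"
    using yablo_layer_mono by (simp add: order_antisym)
qed

text \<open>From \<open>out n\<close> everything is reached through \<open>wit n\<close>; on the way
  back the index falls along alternating \<open>blk\<close> and \<open>alt\<close> down to
  \<open>blk n 0\<close>.\<close>

lemma layer_connected_to_out:
  fixes n :: nat
  defines "E \<equiv> att (restrict yablo {y. layer y = n})"
  assumes "layer x = n"
  shows "(out n, x) \<in> E\<^sup>*" and "(x, out n) \<in> E\<^sup>*"
proof -
  have E: "(y, z) \<in> E" if "(y, z) \<in> yablo_att" "layer y = n" "layer z = n" for y z
    using that by (simp add: E_def restrict_def att_def yablo_def)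
  have ow: "(out n, wit n) \<in> E" by (simp add: E out_wit)
  have wa: "(out n, alt n i) \<in> E\<^sup>*" for i
    using ow E[OF wit_alt] by (meson converse_rtrancl_into_rtrancl layer_simps r_into_rtrancl)
  have ab: "(alt n i, blk n i) \<in> E" for i by (simp add: E alt_blk)
  have bo: "(blk n i, out n) \<in> E\<^sup>*" for i
  proof (induction i)
    case 0
    then show ?case by (simp add: E blk_out r_into_rtrancl)
  next
    case (Suc i)
    have "(blk n (Suc i), alt n i) \<in> E" by (simp add: E blk_alt)
    with ab Suc show ?case by (meson converse_rtrancl_into_rtrancl)
  qed
  have ao: "(alt n i, out n) \<in> E\<^sup>*" for i
    using ab bo by (meson converse_rtrancl_into_rtrancl)
  have wo: "(wit n, out n) \<in> E\<^sup>*"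
    using E[OF wit_alt] ao by (meson converse_rtrancl_into_rtrancl layer_simps)
  show "(out n, x) \<in> E\<^sup>*"
    using assms(2) ow wa ab
    by (cases x rule: node_cases) (auto intro: rtrancl_into_rtrancl)
  show "(x, out n) \<in> E\<^sup>*"
    using assms(2) wo ao bo by (cases x rule: node_cases) auto
qed

lemma comp_restrict_layer:
  "comp (restrict yablo {y. layer y = n}) (out n) = {y. layer y = n}"
  using comp_restrict_subset[of yablo "{y. layer y = n}" "out n"] layer_connected_to_out
  by (auto simp: comp_def scc_def restrict_def args_def yablo_def)

lemma comp_yablo_out: "comp yablo (out n) = {y. layer y = n}"
  using comp_yablo_subset[of "out n"] comp_restrict_layer
    comp_restrict_subset_comp[of yablo "{y. layer y = n}" "out n"] by auto

lemma out_selected: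
  assumes S: "tfstg2 yablo S" and none: "\<And>m. n < m \<Longrightarrow> out m \<notin> S"
  shows "out n \<in> S"
proof -
  let ?L = "{y. layer y = n}"
  have D: "Dset yablo S ?L = {}"
  proof -
    \<comment> \<open>Only \<open>out_alt\<close> joins different layers, and its sources are
      unselected by \<open>none\<close>.\<close>
    have False if "x \<in> S" "layer x \<noteq> layer y" "layer y = n" "(x, y) \<in> yablo_att" for x y
      using that(4) that(1-3) none by cases auto
    then show ?thesis by (auto simp: Dset_def)
  qed
  have "tf_final yablo S (out n) ?L"
    unfolding tf_final_def
  proof (intro conjI ballI impI)
    show "?L \<in> tf_stages yablo S (out n)"
      using tf_zero[of yablo "out n" S] by (simp add: comp_yablo_out)
    show "tf_terminal yablo S (out n) ?L"
      by (simp add: tf_terminal_def tf_step_def D comp_restrict_layer)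
    show "C \<subseteq> ?L" if "C \<in> tf_stages yablo S (out n)" for C
      using tf_stages_subset_comp[OF that] by (simp add: comp_yablo_out)
  qed
  then have stage: "stage (restrict yablo ?L) (S \<inter> ?L)"
    using S by (auto simp: tfstg2_def)
  \<comment> \<open>This set is stable in the layer: \<open>out n\<close> attacks
    \<open>wit n\<close>, and \<open>alt n k\<close> attacks \<open>blk n k\<close>. Hence every
    stage extension of the layer has full range.\<close>
  define T where "T = insert (out n) (range (alt n))"
  have R: "args (restrict yablo ?L) = ?L" "att (restrict yablo ?L) = yablo_att \<inter> ?L \<times> ?L"
    by (simp_all add: restrict_def args_def att_def yablo_def)
  have "conflict_free (restrict yablo ?L) T"
    by (auto simp: conflict_free_def R T_def yablo_attackers)
  moreover have range_T: "plus_range (restrict yablo ?L) T = ?L"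
  proof
    show "plus_range (restrict yablo ?L) T \<subseteq> ?L"
      by (auto simp: plus_range_def R T_def)
    show "?L \<subseteq> plus_range (restrict yablo ?L) T"
    proof
      fix x
      assume "x \<in> ?L"
      then show "x \<in> plus_range (restrict yablo ?L) T"
        by (cases x rule: node_cases) (auto simp: plus_range_def R T_def yablo_attackers)
    qed
  qed
  moreover have "plus_range (restrict yablo ?L) (S \<inter> ?L) \<subseteq> ?L"
    by (auto simp: plus_range_def R)
  ultimately have "plus_range (restrict yablo ?L) (S \<inter> ?L) = ?L"
    using stage unfolding stage_def by (metis psubsetI)
  then have "wit n \<in> plus_range (restrict yablo ?L) (S \<inter> ?L)" by simp
  then have "wit n \<in> S \<or> out n \<in> S"
    by (auto simp: plus_range_def R yablo_attackers)
  moreover have "wit n \<notin> S"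
    using S by (auto simp: tfstg2_def conflict_free_def intro: wit_wit)
  ultimately show ?thesis by blast
qed

text \<open>Downward induction from \<open>i\<close>: a selected argument attacks
  \<open>alt n j\<close>, the only attacker of \<open>blk n j\<close>. So \<open>blk n j\<close>
  survives into a final iterate, which turns out to be a singleton.\<close>

lemma blk_selected:
  assumes S: "tfstg2 yablo S" and m: "out (Suc (n + i)) \<in> S" and "j \<le> i"
  shows "blk n j \<in> S"
  using \<open>j \<le> i\<close>
proof (induction "i - j" arbitrary: j rule: less_induct)
  case less
  have cf: "(x, y) \<notin> yablo_att" if "x \<in> S" "y \<in> S" for x y
    using S that by (auto simp: tfstg2_def conflict_free_def)
  have IH: "blk n k \<in> S" if "j < k" "k \<le> i" for k
    using less that by simp
  have alt: "alt n j \<notin> S"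
  proof (cases "j = i")
    case True
    then show ?thesis using cf m out_alt by blast
  next
    case False
    then have "blk n (Suc j) \<in> S" using IH less.prems by simp
    then show ?thesis using cf blk_alt by blast
  qed
  obtain C where C: "tf_final yablo S (blk n j) C" "blk n j \<in> C"
    using tf_final_exists[of "blk n j" yablo S] alt by (auto simp: yablo_attackers)
  have step: "tf_step yablo S (blk n j) C = C"
    using C by (auto simp: tf_final_def tf_terminal_def)
  note fixed = tf_fixpointD[OF step]
  have layer: "C \<subseteq> {y. layer y = n}"
    using C tf_stages_subset_comp[of C yablo S "blk n j"] comp_yablo_subset[of "blk n j"]
    by (auto simp: tf_final_def)
  \<comment> \<open>Nothing is deleted at a fixed point, so selected attackers of members are
    members.\<close>
  have closed: "x \<in> C" if "x \<in> S" "y \<in> C" "(x, y) \<in> yablo_att" for x y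
    using fixed(1) that by (auto simp: Dset_def)
  have "C = {blk n j}"
  proof (rule ccontr)
    assume "C \<noteq> {blk n j}"
    then obtain c where c: "c \<in> C" "c \<noteq> blk n j" using C by blast
    \<comment> \<open>With a second element in the component, \<open>blk n k\<close> has an attacker
      there, which can only be \<open>alt n k\<close>.\<close>
    have alt_mem: "alt n k \<in> C" if k: "blk n k \<in> C" for k
    proof -
      obtain y where "y \<in> C" "blk n k \<noteq> y" using c C by metis
      then obtain z where "z \<in> C" "(z, blk n k) \<in> yablo_att"
        using comp_internal_attacker[OF fixed(2) k] by auto
      then show ?thesis by (simp add: yablo_attackers)
    qed
    \<comment> \<open>Each \<open>alt n k\<close> pulls in its selected attacker
      \<open>blk n (Suc k)\<close>; at \<open>i\<close> the pull reaches
      \<open>out (Suc (n + i))\<close>, which lies in another layer.\<close>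
    have "blk n k \<in> C" if "j \<le> k" "k \<le> i" for k
      using that
    proof (induction k rule: dec_induct)
      case base
      then show ?case using C by simp
    next
      case (step k)
      then have "blk n k \<in> C" "blk n (Suc k) \<in> S" using IH by simp_all
      then show ?case using closed[OF _ alt_mem blk_alt] by blast
    qed
    then have "blk n i \<in> C" using less.prems by blast
    then have "out (Suc (n + i)) \<in> C"
      using closed[OF m alt_mem out_alt] by blast
    then show False using layer by auto
  qed
  then have "stage (restrict yablo {blk n j}) (S \<inter> {blk n j})"
    using S C by (auto simp: tfstg2_def)
  moreover have "restrict yablo {blk n j} = ({blk n j}, {})"
    by (auto simp: restrict_def args_def att_def yablo_def yablo_attackers)
  ultimately show ?case using stage_isolated by fastforce
qed

lemma no_tfstg2_yablo: "\<not> tfstg2 yablo S"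
proof
  assume S: "tfstg2 yablo S"
  have iff: "out n \<in> S \<longleftrightarrow> (\<forall>m>n. out m \<notin> S)" for n
  proof
    assume n: "out n \<in> S"
    show "\<forall>m>n. out m \<notin> S"
    proof (intro allI impI notI)
      fix m
      assume "n < m" "out m \<in> S"
      then have "blk n 0 \<in> S"
        using blk_selected[OF S, of n "m - n - 1" 0] by simp
      with n S show False
        by (auto simp: tfstg2_def conflict_free_def intro: blk_out)
    qed
  qed (use out_selected[OF S] in blast)
  \<comment> \<open>If \<open>out n\<close> were selected, \<open>out (Suc n)\<close> would be
    unselected although nothing above it is selected. So none is selected, and then
    \<open>iff\<close> selects all.\<close>
  then show False by (meson lessI less_trans)
qed

section \<open>Failure of directionality\<close>

lemma sccs_empty: "sccs (restrict F {}) = {}"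
  by (simp add: sccs_def restrict_def args_def)

text \<open>Having no component is not having exactly one, so the recursive rule applies, with no
  calls to make.\<close>

lemma cf2_empty: "cf2 (restrict F {}) {}"
  by (rule cf2_rec) (simp_all add: sccs_empty)

lemma stg2_empty: "stg2 (restrict F {}) {}"
  by (rule stg2_rec) (simp_all add: sccs_empty)

lemma tfstg2_empty: "tfstg2 (restrict F {}) {}"
  by (simp add: tfstg2_def conflict_free_def restrict_def args_def)

theorem theorem3:
  shows "(\<exists>(F :: nat af) U. af_wf F \<and> finitary F \<and> U \<subseteq> args F \<and> unattacked F U \<and>
            {S. cf2 (restrict F U) S} \<noteq> (\<lambda>S. S \<inter> U) ` {S. cf2 F S})
       \<and> (\<exists>(F :: nat af) U. af_wf F \<and> finitary F \<and> U \<subseteq> args F \<and> unattacked F U \<and>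
            {S. stg2 (restrict F U) S} \<noteq> (\<lambda>S. S \<inter> U) ` {S. stg2 F S})
       \<and> (\<exists>(F :: nat af) U. af_wf F \<and> finitary F \<and> U \<subseteq> args F \<and> unattacked F U \<and>
            {S. tfstg2 (restrict F U) S} \<noteq> (\<lambda>S. S \<inter> U) ` {S. tfstg2 F S})"
proof (intro conjI)
  have fails: "\<exists>(F :: nat af) U. af_wf F \<and> finitary F \<and> U \<subseteq> args F \<and> unattacked F U \<and>
      {S. \<sigma> (restrict F U) S} \<noteq> (\<lambda>S. S \<inter> U) ` {S. \<sigma> F S}"
    if "af_wf F" "finitary F" "\<sigma> (restrict F {}) {}" "\<And>S. \<not> \<sigma> F S"
    for \<sigma> :: "nat af \<Rightarrow> nat set \<Rightarrow> bool" and F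
    \<comment> \<open>With \<open>U = {}\<close> the left-hand set contains \<open>{}\<close>, while
      the image on the right is empty.\<close>
    using that by (intro exI[of _ F] exI[of _ "{}"]) (auto simp: unattacked_def)
  show "\<exists>(F :: nat af) U. af_wf F \<and> finitary F \<and> U \<subseteq> args F \<and> unattacked F U \<and>
      {S. cf2 (restrict F U) S} \<noteq> (\<lambda>S. S \<inter> U) ` {S. cf2 F S}"
    using cf2_not_ladder by (intro fails[of "ladder 0"] af_wf_ladder finitary_ladder cf2_empty) blast
  show "\<exists>(F :: nat af) U. af_wf F \<and> finitary F \<and> U \<subseteq> args F \<and> unattacked F U \<and>
      {S. stg2 (restrict F U) S} \<noteq> (\<lambda>S. S \<inter> U) ` {S. stg2 F S}"
    using stg2_not_ladder by (intro fails[of "ladder 0"] af_wf_ladder finitary_ladder stg2_empty) blast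
  show "\<exists>(F :: nat af) U. af_wf F \<and> finitary F \<and> U \<subseteq> args F \<and> unattacked F U \<and>
      {S. tfstg2 (restrict F U) S} \<noteq> (\<lambda>S. S \<inter> U) ` {S. tfstg2 F S}"
    by (intro fails[of yablo] af_wf_yablo finitary_yablo tfstg2_empty no_tfstg2_yablo)
qed

end
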